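(* Let $\mu$ be a finite positive Borel measure on the open unit disk $\mathbb{D}$ satisfying $$\mu(S(I))=O(\phi(|I|))\qquad(|I|\to0),$$ where $I$ ranges over arcs of the unit circle and $\phi:(0,2\pi]\to(0,\infty)$ is an increasing function such that $$\int_0^{2\pi}\frac{\phi(x)}{x}\,dx<\infty.$$ Then $\mu$ is a Carleson measure for the Dirichlet space $\mathcal{D}$.
   Context: $\mathbb{D}$ denotes the open unit disk in $\mathbb{C}$, and $\mathbb{T}$ the unit circle. For an arc $I\subset\mathbb{T}$, $|I|$ denotes its arclength, and the associated Carleson box is $S(I):=\{re^{i\theta}:1-|I|<r<1,\ e^{i\theta}\in I\}$. The condition $\mu(S(I))=O(\phi(|I|))$ as $|I|\to0$ means that there exist constants $C,\delta>0$ such that $\mu(S(I))\le C\phi(|I|)$ for every arc $I\subset\mathbb{T}$ with $0<|I|<\delta$. The Dirichlet space $\mathcal{D}$ is the space of functions $f$ holomorphic in $\mathbb{D}$ with finite Dirichlet integral $\mathcal{D}(f):=\frac1\pi\int_{\mathbb{D}}|f'(z)|^2\,dA(z)<\infty$ ($dA$ is area Lebesgue measure), normed by $\|f\|_{\mathcal{D}}^2:=|f(0)|^2+\mathcal{D}(f)$. A positive measure $\mu$ on $\mathbb{D}$ is a Carleson measure for $\mathcal{D}$ if there exists a constant $C$ such that $\int_{\mathbb{D}}|f(z)|^2\,d\mu(z)\le C\|f\|_{\mathcal{D}}^2$ for all $f\in\mathcal{D}$. *)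

theory Defs
  imports "HOL-Analysis.Analysis"
begin

abbreviation unit_disk :: "complex set"
  where "unit_disk \<equiv> ball 0 1"

text \<open>Arcs may be open, closed or half-open.  An interval of length at least
  \<open>2 * pi\<close> yields the whole circle.\<close>

definition circle_arc :: "complex set \<Rightarrow> bool"
  where "circle_arc I \<longleftrightarrow> (\<exists>J::real set. is_interval J \<and> I = cis ` J)"

definition arclength :: "complex set \<Rightarrow> real"
  where "arclength I = measure lborel {\<theta> \<in> {0..<2 * pi}. cis \<theta> \<in> I}"

text \<open>The constraint \<open>0 \<le> r\<close> is the usual convention for polar coordinates; it matters
  only for arcs longer than 1.\<close>

definition carleson_box :: "complex set \<Rightarrow> complex set"
  where "carleson_box I =
    {of_real r * cis \<theta> | r \<theta>. 0 \<le> r \<and> 1 - arclength I < r \<and> r < 1 \<and> cis \<theta> \<in> I}"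

definition carleson_box_bigo :: "complex measure \<Rightarrow> (real \<Rightarrow> real) \<Rightarrow> bool"
  where "carleson_box_bigo \<mu> \<phi> \<longleftrightarrow>
    (\<exists>C>0. \<exists>\<delta>>0. \<forall>I. circle_arc I \<and> 0 < arclength I \<and> arclength I < \<delta> \<longrightarrow>
       measure \<mu> (carleson_box I) \<le> C * \<phi> (arclength I))"

definition dirichlet_integral :: "(complex \<Rightarrow> complex) \<Rightarrow> ennreal"
  where "dirichlet_integral f =
    ennreal (1 / pi) * (\<integral>\<^sup>+z\<in>unit_disk. ennreal ((cmod (deriv f z))\<^sup>2) \<partial>lborel)"

definition dirichlet_space :: "(complex \<Rightarrow> complex) set"
  where "dirichlet_space = {f. f holomorphic_on unit_disk \<and> dirichlet_integral f < \<infinity>}"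

definition dirichlet_norm :: "(complex \<Rightarrow> complex) \<Rightarrow> real"
  where "dirichlet_norm f = sqrt ((cmod (f 0))\<^sup>2 + enn2real (dirichlet_integral f))"

definition dirichlet_carleson_measure :: "complex measure \<Rightarrow> bool"
  where "dirichlet_carleson_measure \<mu> \<longleftrightarrow>
    (\<exists>C::real. \<forall>f\<in>dirichlet_space.
       (\<integral>\<^sup>+z. ennreal ((cmod (f z))\<^sup>2) \<partial>\<mu>) \<le> ennreal (C * (dirichlet_norm f)\<^sup>2))"

end

theory Submission
  imports Defs "HOL-Complex_Analysis.Complex_Analysis"
begin

text \<open>Write \<open>f z = (\<Sum>n. a n * z ^ n)\<close>.  The squared Dirichlet norm is comparable to the weighted coefficient
sum \<open>(\<Sum>n. (n + 1) * (cmod (a n))\<^sup>2)\<close>, so the reproducing kernel of the space is, up to equivalence of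
norms, \<open>(\<Sum>n. (z * cnj \<zeta>) ^ n / (n + 1))\<close>, whose size is governed by \<open>ln (1 / cmod (1 - z * cnj \<zeta>))\<close>.
By duality, a measure \<open>\<mu>\<close> is Carleson as soon as the integral operator with this kernel is bounded on
\<open>L\<^sup>2 \<mu>\<close>.  By Schur's test it suffices that the integral of the kernel with respect to \<open>\<mu>\<close> in one variable
is bounded uniformly in the other.

By the layer-cake formula this integral is bounded by a multiple of the total mass plus a sum over
\<open>n\<close> of \<open>1 / (n + 1)\<close> times the \<open>\<mu>\<close>-measure of the points \<open>z\<close> of the disk with
\<open>cmod (1 - z * cnj \<zeta>) < 1 / n\<close>.  For large \<open>n\<close> these points lie in a Carleson box over an arc of
length \<open>O(1 / n)\<close>.  The box condition therefore bounds their measure by a constant times \<open>\<phi> (c / n)\<close>, and since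
\<open>\<phi>\<close> is increasing, the sum of \<open>\<phi> (c / n) / n\<close> is a lower Riemann sum for the convergent integral of
\<open>\<phi> x / x\<close>.

All estimates are made for the partial sums of the Taylor series of \<open>f\<close> and for correspondingly
truncated kernels, with constants independent of the truncation
(\<open>log_series_le\<close>, \<open>polynomial_L2_le_by_schur_test\<close>, \<open>box_condition_near_diagonal_sum_bounded\<close>); Fatou's
lemma passes to \<open>f\<close>.  The coefficient bound \<open>taylor_coeffs_le_dirichlet_integral\<close> combines Parseval's
identity on circles with the rotation invariance of area.\<close>

section \<open>Rotation invariance of Lebesgue measure\<close>

lemma nn_integral_lborel_translate:
  fixes f :: "'a::euclidean_space \<Rightarrow> ennreal"
  assumes [measurable]: "f \<in> borel_measurable borel"
  shows "(\<integral>\<^sup>+x. f (c + x) \<partial>lborel) = (\<integral>\<^sup>+x. f x \<partial>lborel)"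
proof -
  have "(\<integral>\<^sup>+x. f x \<partial>lborel) = (\<integral>\<^sup>+x. f x \<partial>distr lborel borel ((+) c))"
    by (simp add: lborel_distr_plus)
  also have "\<dots> = (\<integral>\<^sup>+x. f (c + x) \<partial>lborel)"
    by (subst nn_integral_distr) auto
  finally show ?thesis ..
qed

text \<open>Every sigma-finite translation-invariant Borel measure that agrees with Lebesgue measure on unit
balls equals it, and the image of Lebesgue measure under \<open>T\<close> is such a measure.  The proof multiplies
the left side by the volume \<open>c\<close> of the unit ball, written as the integral of its indicator \<open>g y\<close>.
Inside the double integral \<open>f (T x)\<close> may be replaced by \<open>f (T x + y)\<close>, and the substitution of
\<open>y - T x\<close> for \<open>y\<close> moves the translation into \<open>g\<close>.  What remains is the integral of \<open>f\<close> times the volume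
of a translated unit ball, which is again \<open>c\<close>.\<close>

lemma nn_integral_lborel_orthogonal:
  fixes f :: "'a::euclidean_space \<Rightarrow> ennreal" and T :: "'a \<Rightarrow> 'a"
  assumes f [measurable]: "f \<in> borel_measurable borel" and T: "orthogonal_transformation T"
  shows "(\<integral>\<^sup>+x. f (T x) \<partial>lborel) = (\<integral>\<^sup>+x. f x \<partial>lborel)"
proof -
  define g :: "'a \<Rightarrow> ennreal" where "g = indicator (ball 0 1)"
  define c where "c = emeasure lborel (ball (0::'a) 1)"
  have lin: "linear T" and bij: "bij T"
    using T orthogonal_transformation_linear orthogonal_transformation_bij by auto
  have cont: "continuous_on UNIV T"
    using lin by (rule linear_continuous_on[OF linear_conv_bounded_linear[THEN iffD1]])
  have [measurable]: "T \<in> borel_measurable borel"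
    using cont by (rule borel_measurable_continuous_onI)
  have [measurable]: "g \<in> borel_measurable borel"
    unfolding g_def by (intro borel_measurable_indicator borel_open open_ball)
  have ball: "emeasure lborel (ball y 1) = c" for y :: 'a
    by (simp add: c_def emeasure_ball)
  have g: "(\<integral>\<^sup>+y. g y \<partial>lborel) = c"
    by (simp add: g_def c_def)
  have shift: "(\<integral>\<^sup>+x. f (T x + y) \<partial>lborel) = (\<integral>\<^sup>+x. f (T x) \<partial>lborel)" for y
  proof -
    have "T (inv T y + x) = T x + y" for x
      using lin bij by (simp add: linear_add bij_is_surj surj_f_inv_f add.commute)
    then show ?thesis
      using nn_integral_lborel_translate[of "\<lambda>x. f (T x)" "inv T y"] by simp
  qed
  have gint: "(\<integral>\<^sup>+x. g (y - T x) \<partial>lborel) = c" for y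
  proof -
    have "g (y - T x) = indicator (ball (inv T y) 1) x" for x
    proof -
      have "norm (y - T x) = norm (T (inv T y - x))"
        using lin bij by (simp add: linear_diff bij_is_surj surj_f_inv_f)
      also have "\<dots> = dist (inv T y) x"
        using T by (simp add: orthogonal_transformation_norm dist_norm)
      finally show ?thesis by (simp add: g_def indicator_def)
    qed
    then show ?thesis by (simp add: ball)
  qed
  have "c * (\<integral>\<^sup>+x. f (T x) \<partial>lborel) = (\<integral>\<^sup>+y. (\<integral>\<^sup>+x. f (T x) \<partial>lborel) * g y \<partial>lborel)"
    by (subst nn_integral_cmult) (simp_all add: g mult.commute)
  also have "\<dots> = (\<integral>\<^sup>+y. (\<integral>\<^sup>+x. f (T x + y) * g y \<partial>lborel) \<partial>lborel)"
    by (subst nn_integral_multc) (simp_all add: shift)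
  also have "\<dots> = (\<integral>\<^sup>+x. (\<integral>\<^sup>+y. f (T x + y) * g y \<partial>lborel) \<partial>lborel)"
    by (rule lborel_pair.Fubini') measurable
  also have "\<dots> = (\<integral>\<^sup>+x. (\<integral>\<^sup>+y. f y * g (y - T x) \<partial>lborel) \<partial>lborel)"
  proof (rule nn_integral_cong)
    fix x
    show "(\<integral>\<^sup>+y. f (T x + y) * g y \<partial>lborel) = (\<integral>\<^sup>+y. f y * g (y - T x) \<partial>lborel)"
      using nn_integral_lborel_translate[of "\<lambda>y. f y * g (y - T x)" "T x"] by simp
  qed
  also have "\<dots> = (\<integral>\<^sup>+y. (\<integral>\<^sup>+x. f y * g (y - T x) \<partial>lborel) \<partial>lborel)"
    by (rule lborel_pair.Fubini') measurable
  also have "\<dots> = (\<integral>\<^sup>+y. f y * c \<partial>lborel)"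
    by (subst nn_integral_cmult) (simp_all add: gint)
  also have "\<dots> = c * (\<integral>\<^sup>+y. f y \<partial>lborel)"
    by (subst nn_integral_multc) (simp_all add: mult.commute)
  finally have *: "c * (\<integral>\<^sup>+x. f (T x) \<partial>lborel) = c * (\<integral>\<^sup>+y. f y \<partial>lborel)" .
  have "unit_ball_vol (real DIM('a)) > 0" by simp
  then have "unit_ball_vol (real DIM('a)) \<noteq> 0" by linarith
  then have "c \<noteq> 0"
    by (simp add: c_def emeasure_ball)
  moreover have "c \<noteq> \<infinity>"
    by (simp add: c_def emeasure_ball)
  ultimately show ?thesis
    using * by (simp add: ennreal_mult_cancel_left)
qed

section \<open>Taylor coefficients and the Dirichlet integral\<close>

lemma has_integral_cis_int_mult:
  "((\<lambda>t. cis (real_of_int k * t)) has_integral (if k = 0 then of_real (2 * pi) else 0)) {0..2 * pi}"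
proof (cases "k = 0")
  case True
  then show ?thesis
    using has_integral_const_real[of "1::complex" 0 "2 * pi"] by (simp add: scaleR_conv_of_real)
next
  case False
  define F where "F = (\<lambda>t. cis (real_of_int k * t) / (\<i> * of_int k))"
  have "(F has_vector_derivative cis (real_of_int k * t)) (at t within {0..2 * pi})" for t
    unfolding F_def cis_conv_exp using False
    by (auto intro!: derivative_eq_intros has_vector_derivative_real_field simp: field_simps)
  then have "((\<lambda>t. cis (real_of_int k * t)) has_integral (F (2 * pi) - F 0)) {0..2 * pi}"
    by (intro fundamental_theorem_of_calculus) auto
  moreover have "F (2 * pi) = F 0"
    using cis_multiple_2pi[of "of_int k"] by (simp add: F_def mult.commute mult.left_commute)
  ultimately show ?thesis using False by simp
qed

lemma trig_polynomial_parseval: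
  fixes b :: "nat \<Rightarrow> complex"
  shows "((\<lambda>t. (cmod (\<Sum>n<M. b n * cis t ^ n))\<^sup>2) has_integral 2 * pi * (\<Sum>n<M. (cmod (b n))\<^sup>2)) {0..2 * pi}"
proof -
  have expand: "complex_of_real ((cmod (\<Sum>n<M. b n * cis t ^ n))\<^sup>2) =
      (\<Sum>n<M. \<Sum>m<M. b n * cnj (b m) * cis (real_of_int (int n - int m) * t))" for t
  proof -
    have "cis t ^ n * cnj (cis t ^ m) = cis (real_of_int (int n - int m) * t)" for n m
      by (simp add: Complex.DeMoivre cis_cnj cis_mult left_diff_distrib)
    then have "b n * cis t ^ n * cnj (b m * cis t ^ m) =
        b n * cnj (b m) * cis (real_of_int (int n - int m) * t)" for n m
      by (simp add: mult.assoc mult.left_commute)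
    then show ?thesis
      by (simp only: complex_norm_square cnj_sum sum_product)
  qed
  have "((\<lambda>t. \<Sum>n<M. \<Sum>m<M. b n * cnj (b m) * cis (real_of_int (int n - int m) * t)) has_integral
      (\<Sum>n<M. \<Sum>m<M. b n * cnj (b m) * (if int n - int m = 0 then of_real (2 * pi) else 0))) {0..2 * pi}"
    by (intro has_integral_sum has_integral_mult_right has_integral_cis_int_mult) auto
  also have "(\<Sum>n<M. \<Sum>m<M. b n * cnj (b m) * (if int n - int m = 0 then of_real (2 * pi) else 0)) =
      (\<Sum>n<M. b n * cnj (b n) * of_real (2 * pi))"
    by (intro sum.cong refl) (simp add: if_distrib[of "\<lambda>x. _ * x"] cong: if_cong)
  also have "\<dots> = complex_of_real (2 * pi * (\<Sum>n<M. (cmod (b n))\<^sup>2))"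
    by (simp add: complex_norm_square sum_distrib_left mult.commute of_real_sum del: of_real_power)
  finally have "((\<lambda>t. complex_of_real ((cmod (\<Sum>n<M. b n * cis t ^ n))\<^sup>2)) has_integral
      complex_of_real (2 * pi * (\<Sum>n<M. (cmod (b n))\<^sup>2))) {0..2 * pi}"
    by (simp only: expand)
  from has_integral_Re[OF this] show ?thesis by simp
qed

text \<open>Parseval's identity on the circle of radius \<open>cmod z\<close>, obtained from the partial sums of the series by
dominated convergence.  Only the bound from below by finitely many coefficients is kept, because it
is to be integrated over the disk.\<close>

lemma power_series_circle_mean_ge:
  fixes c :: "nat \<Rightarrow> complex"
  assumes summ: "summable (\<lambda>n. cmod (c n * z ^ n))"
    and h: "\<And>t. (\<lambda>n. c n * (cis t * z) ^ n) sums h (cis t * z)"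
  shows "(\<lambda>t. (cmod (h (cis t * z)))\<^sup>2) integrable_on {0..2 * pi}"
    and "2 * pi * (\<Sum>n<N. (cmod (c n))\<^sup>2 * (cmod z)^(2 * n)) \<le> integral {0..2 * pi} (\<lambda>t. (cmod (h (cis t * z)))\<^sup>2)"
proof -
  define H where "H = (\<lambda>M t. (cmod (\<Sum>n<M. c n * z ^ n * cis t ^ n))\<^sup>2)"
  define S where "S = (\<Sum>n. cmod (c n * z ^ n))"
  have int: "(H M has_integral 2 * pi * (\<Sum>n<M. (cmod (c n * z ^ n))\<^sup>2)) {0..2 * pi}" for M
    unfolding H_def by (rule trig_polynomial_parseval)
  have lim: "(\<lambda>M. H M t) \<longlonglongrightarrow> (cmod (h (cis t * z)))\<^sup>2" for t
    using h[of t] unfolding sums_def H_def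
    by (intro tendsto_intros) (simp add: power_mult_distrib mult_ac)
  have bound: "norm (H M t) \<le> S\<^sup>2" for M t
  proof -
    have "cmod (\<Sum>n<M. c n * z ^ n * cis t ^ n) \<le> (\<Sum>n<M. cmod (c n * z ^ n * cis t ^ n))"
      by (rule norm_sum)
    also have "\<dots> = (\<Sum>n<M. cmod (c n * z ^ n))"
      by (simp add: norm_mult norm_power)
    also have "\<dots> \<le> S"
      unfolding S_def using summ by (rule sum_le_suminf) auto
    finally show ?thesis by (simp add: H_def power_mono)
  qed
  have dc: "(\<lambda>t. (cmod (h (cis t * z)))\<^sup>2) integrable_on {0..2 * pi}"
      "(\<lambda>M. integral {0..2 * pi} (H M)) \<longlonglongrightarrow> integral {0..2 * pi} (\<lambda>t. (cmod (h (cis t * z)))\<^sup>2)"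
    using dominated_convergence[of H "{0..2 * pi}" "\<lambda>_. S\<^sup>2" "\<lambda>t. (cmod (h (cis t * z)))\<^sup>2"]
      int bound lim by (auto intro: integrable_const_ivl)
  show "(\<lambda>t. (cmod (h (cis t * z)))\<^sup>2) integrable_on {0..2 * pi}" by (fact dc)
  have "2 * pi * (\<Sum>n<N. (cmod (c n * z ^ n))\<^sup>2) \<le> integral {0..2 * pi} (H M)" if "N \<le> M" for M
    using that by (subst integral_unique[OF int]) (auto intro!: sum_mono2)
  then have "2 * pi * (\<Sum>n<N. (cmod (c n * z ^ n))\<^sup>2) \<le> integral {0..2 * pi} (\<lambda>t. (cmod (h (cis t * z)))\<^sup>2)"
    by (intro LIMSEQ_le_const[OF dc(2)]) auto
  then show "2 * pi * (\<Sum>n<N. (cmod (c n))\<^sup>2 * (cmod z)^(2 * n)) \<le> integral {0..2 * pi} (\<lambda>t. (cmod (h (cis t * z)))\<^sup>2)"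
    by (simp add: norm_mult norm_power power_mult_distrib mult.commute flip: power_mult)
qed

text \<open>The annulus \<open>n / (n + 1) \<le> (cmod z)\<^sup>2 < 1\<close> has area \<open>pi / (n + 1)\<close>, and there the integrand is at least
\<open>(n / (n + 1)) ^ n \<ge> exp (- 1) \<ge> 1 / 3\<close>.\<close>

lemma nn_integral_disk_power_ge:
  "ennreal (pi / (3 * real (n + 1))) \<le> (\<integral>\<^sup>+z\<in>unit_disk. ennreal ((cmod z) ^ (2 * n)) \<partial>lborel)"
proof -
  define q where "q = real n / real (n + 1)"
  define A where "A = unit_disk - ball 0 (sqrt q)"
  have q: "0 \<le> q" "q < 1" by (auto simp: q_def)
  have "emeasure lborel A = emeasure lborel unit_disk - emeasure lborel (ball (0::complex) (sqrt q))"
    unfolding A_def using q real_sqrt_lt_1_iff[of q]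
    by (intro emeasure_Diff subset_ball) (auto simp: emeasure_ball)
  also have "\<dots> = ennreal (pi - pi * q)"
    using q by (simp add: emeasure_ball unit_ball_vol_2 ennreal_minus)
  also have "pi - pi * q = pi / real (n + 1)"
    by (simp add: q_def field_simps)
  finally have A: "emeasure lborel A = ennreal (pi / real (n + 1))" .
  have [measurable]: "A \<in> sets borel" unfolding A_def by measurable
  have qn: "1 / 3 \<le> q ^ n"
  proof (cases "n = 0")
    case False
    have "(1 + 1 / real n) ^ n \<le> exp (1 / real n) ^ n"
      by (intro power_mono exp_ge_add_one_self) auto
    also have "\<dots> = exp 1"
      using False by (simp flip: exp_of_nat_mult)
    also have "\<dots> \<le> 3" by (rule exp_le)
    finally have "(1 + 1 / real n) ^ n \<le> 3" .
    moreover have "q = inverse (1 + 1 / real n)"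
      using False by (simp add: q_def field_simps)
    moreover have "0 < (1 + 1 / real n) ^ n"
      by (intro zero_less_power) (simp add: add_pos_nonneg)
    ultimately show ?thesis
      by (simp add: power_inverse field_simps)
  qed simp
  have ge: "1 / 3 \<le> cmod z ^ (2 * n)" if "z \<in> A" for z
  proof -
    have "q \<le> (cmod z)\<^sup>2"
      using that q by (auto simp: A_def real_sqrt_le_iff sqrt_le_D)
    then have "q ^ n \<le> cmod z ^ (2 * n)"
      using q by (auto simp: power_mult intro: power_mono)
    then show ?thesis using qn by linarith
  qed
  have "ennreal (pi / (3 * real (n + 1))) = ennreal (1 / 3) * emeasure lborel A"
    unfolding A by (simp flip: ennreal_mult)
  also have "\<dots> = (\<integral>\<^sup>+z. ennreal (1 / 3) * indicator A z \<partial>lborel)"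
    by (simp add: nn_integral_cmult_indicator)
  also have "\<dots> \<le> (\<integral>\<^sup>+z\<in>unit_disk. ennreal ((cmod z) ^ (2 * n)) \<partial>lborel)"
    using ge by (intro nn_integral_mono) (auto simp: A_def indicator_def simp del: ennreal_power intro!: ennreal_leI)
  finally show ?thesis .
qed

text \<open>Up to a constant, this is the inequality between the coefficient form and the area form of the
Dirichlet seminorm.  By rotation invariance the area integral of \<open>(cmod (deriv f z))\<^sup>2\<close> is unchanged
when the integrand is replaced by its mean over the circle through \<open>z\<close>.  Parseval's identity bounds
this mean below by powers of \<open>cmod z\<close>, which are then integrated over the disk.\<close>

lemma taylor_coeffs_le_dirichlet_integral:
  assumes hol: "f holomorphic_on unit_disk"
  defines "a \<equiv> (\<lambda>n. (deriv ^^ n) f 0 / fact n)"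
  shows "ennreal (\<Sum>n<N. real (n + 1) * (cmod (a (n + 1)))\<^sup>2) \<le> 3 * dirichlet_integral f"
proof -
  define h where "h = deriv f"
  define c where "c = (\<lambda>n. (deriv ^^ n) h 0 / fact n)"
  define F where "F = (\<lambda>z. indicator unit_disk z *\<^sub>R (cmod (h z))\<^sup>2)"
  define I where "I = (\<integral>\<^sup>+z\<in>unit_disk. ennreal ((cmod (deriv f z))\<^sup>2) \<partial>lborel)"
  have h: "h holomorphic_on unit_disk"
    unfolding h_def using hol by (simp add: holomorphic_deriv)
  have [measurable]: "F \<in> borel_measurable borel"
    unfolding F_def using h
    by (intro borel_measurable_continuous_on_indicator continuous_intros holomorphic_on_imp_continuous_on) auto
  have [measurable]: "(indicator unit_disk :: complex \<Rightarrow> ennreal) \<in> borel_measurable borel"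
    by (intro borel_measurable_indicator borel_open open_ball)
  have [measurable]: "cis \<in> borel_measurable borel"
    by (intro borel_measurable_continuous_onI continuous_intros)
  have "1 + complex_of_nat n \<noteq> 0" for n
    by (metis of_nat_Suc of_nat_neq_0)
  then have c: "c n = real (n + 1) * a (n + 1)" for n
    by (simp add: c_def a_def h_def funpow_Suc_right o_def del: funpow.simps)
  have I: "I = (\<integral>\<^sup>+z. ennreal (F z) \<partial>lborel)"
    unfolding I_def by (intro nn_integral_cong) (auto simp: F_def h_def indicator_def)
  have rot: "(\<integral>\<^sup>+z. ennreal (F (cis t * z)) \<partial>lborel) = I" for t
    unfolding I
    by (intro nn_integral_lborel_orthogonal[of "\<lambda>z. ennreal (F z)"])
       (auto simp: orthogonal_transformation norm_mult intro!: linearI simp: algebra_simps)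
  have mean: "(\<integral>\<^sup>+t\<in>{0..2 * pi}. ennreal (F (cis t * z)) \<partial>lborel) \<ge>
      ennreal (2 * pi) * (ennreal (\<Sum>n<N. (cmod (c n))\<^sup>2 * (cmod z)^(2 * n)) * indicator unit_disk z)" for z
  proof (cases "z \<in> unit_disk")
    case True
    then have Fz: "F (cis t * z) = (cmod (h (cis t * z)))\<^sup>2" for t
      by (simp add: F_def norm_mult)
    have sums: "(\<lambda>n. c n * w ^ n) sums h w" if "w \<in> unit_disk" for w
      using holomorphic_power_series[OF h that] by (simp add: c_def)
    have summ: "summable (\<lambda>n. cmod (c n * z ^ n))"
    proof -
      obtain r where r: "cmod z < r" "r < 1"
        using True dense[of "cmod z" 1] by auto
      have "summable (\<lambda>n. c n * of_real r ^ n)"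
        using sums[of "of_real r"] r order_le_less_trans[OF norm_ge_zero r(1)] by (auto simp: sums_iff)
      then show ?thesis
        by (rule powser_insidea) (use r in auto)
    qed
    have *: "(\<lambda>n. c n * (cis t * z) ^ n) sums h (cis t * z)" for t
      using True by (intro sums) (simp add: norm_mult)
    have eq: "(\<integral>\<^sup>+t\<in>{0..2 * pi}. ennreal (F (cis t * z)) \<partial>lborel) =
        ennreal (integral {0..2 * pi} (\<lambda>t. F (cis t * z)))"
    proof -
      have "((\<lambda>t. F (cis t * z)) has_integral integral {0..2 * pi} (\<lambda>t. F (cis t * z))) {0..2 * pi}"
        using power_series_circle_mean_ge(1)[of c z h, OF summ *] by (simp add: Fz has_integral_integral)
      then have "((\<lambda>t. if t \<in> {0..2 * pi} then F (cis t * z) else 0) has_integral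
          integral {0..2 * pi} (\<lambda>t. F (cis t * z))) UNIV"
        by (simp only: has_integral_restrict_UNIV)
      then have "(\<integral>\<^sup>+t. ennreal (if t \<in> {0..2 * pi} then F (cis t * z) else 0) \<partial>lborel) =
          ennreal (integral {0..2 * pi} (\<lambda>t. F (cis t * z)))"
      proof (rule nn_integral_has_integral_lborel[rotated 2])
        show "(\<lambda>t. if t \<in> {0..2 * pi} then F (cis t * z) else 0) \<in> borel_measurable borel"
          by (intro measurable_If_set) auto
      qed (auto simp: Fz)
      also have "(\<lambda>t. ennreal (if t \<in> {0..2 * pi} then F (cis t * z) else 0)) =
          (\<lambda>t. ennreal (F (cis t * z)) * indicator {0..2 * pi} t)"
        by (auto simp: indicator_def)
      finally show ?thesis .
    qed
    show ?thesis
      unfolding eq using True ennreal_leI[OF power_series_circle_mean_ge(2)[of c z h N, OF summ *]]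
      by (simp add: Fz ennreal_mult' mult.assoc)
  qed simp
  have "ennreal (2 * pi) * I = (\<integral>\<^sup>+t. I * indicator {0..2 * pi} t \<partial>lborel)"
    by (subst nn_integral_cmult) (auto simp: mult.commute)
  also have "\<dots> = (\<integral>\<^sup>+t. (\<integral>\<^sup>+z. ennreal (F (cis t * z)) * indicator {0..2 * pi} t \<partial>lborel) \<partial>lborel)"
    by (intro nn_integral_cong, subst nn_integral_multc) (auto simp: rot)
  also have "\<dots> = (\<integral>\<^sup>+z. (\<integral>\<^sup>+t\<in>{0..2 * pi}. ennreal (F (cis t * z)) \<partial>lborel) \<partial>lborel)"
    by (rule lborel_pair.Fubini') measurable
  also have "\<dots> \<ge> (\<integral>\<^sup>+z. ennreal (2 * pi) * (ennreal (\<Sum>n<N. (cmod (c n))\<^sup>2 * (cmod z)^(2 * n)) * indicator unit_disk z) \<partial>lborel)"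
    by (intro nn_integral_mono mean)
  also have "(\<integral>\<^sup>+z. ennreal (2 * pi) * (ennreal (\<Sum>n<N. (cmod (c n))\<^sup>2 * (cmod z)^(2 * n)) * indicator unit_disk z) \<partial>lborel) =
      ennreal (2 * pi) * (\<integral>\<^sup>+z. (\<Sum>n<N. ennreal ((cmod (c n))\<^sup>2) * (ennreal ((cmod z)^(2 * n)) * indicator unit_disk z)) \<partial>lborel)"
    by (subst nn_integral_cmult)
       (auto simp: sum_distrib_right mult.assoc ennreal_mult' simp flip: sum_ennreal simp del: ennreal_power)
  finally have "(\<integral>\<^sup>+z. (\<Sum>n<N. ennreal ((cmod (c n))\<^sup>2) * (ennreal ((cmod z)^(2 * n)) * indicator unit_disk z)) \<partial>lborel) \<le> I"
    by (simp add: ennreal_mult_le_mult_iff)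
  also have "(\<integral>\<^sup>+z. (\<Sum>n<N. ennreal ((cmod (c n))\<^sup>2) * (ennreal ((cmod z)^(2 * n)) * indicator unit_disk z)) \<partial>lborel)
      = (\<Sum>n<N. ennreal ((cmod (c n))\<^sup>2) * (\<integral>\<^sup>+z\<in>unit_disk. ennreal ((cmod z) ^ (2 * n)) \<partial>lborel))"
    by (subst nn_integral_sum) (auto intro!: sum.cong nn_integral_cmult simp del: ennreal_power)
  finally have upper: "(\<Sum>n<N. ennreal ((cmod (c n))\<^sup>2) *
      (\<integral>\<^sup>+z\<in>unit_disk. ennreal ((cmod z) ^ (2 * n)) \<partial>lborel)) \<le> I" .
  have "(\<Sum>n<N. ennreal ((cmod (c n))\<^sup>2) * ennreal (pi / (3 * real (n + 1))))
      \<le> (\<Sum>n<N. ennreal ((cmod (c n))\<^sup>2) * (\<integral>\<^sup>+z\<in>unit_disk. ennreal ((cmod z) ^ (2 * n)) \<partial>lborel))"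
    by (intro sum_mono mult_left_mono nn_integral_disk_power_ge) auto
  also note upper
  also have "(\<Sum>n<N. ennreal ((cmod (c n))\<^sup>2) * ennreal (pi / (3 * real (n + 1)))) =
      ennreal (\<Sum>n<N. pi / 3 * (real (n + 1) * (cmod (a (n + 1)))\<^sup>2))"
    by (subst sum_ennreal[symmetric])
       (auto intro!: sum.cong simp: c norm_mult power_mult_distrib power2_eq_square field_simps
        simp flip: ennreal_mult simp del: of_nat_add of_nat_Suc)
  also have "\<dots> = ennreal (pi / 3) * ennreal (\<Sum>n<N. real (n + 1) * (cmod (a (n + 1)))\<^sup>2)"
    by (simp add: sum_distrib_left sum_nonneg flip: ennreal_mult)
  finally have "ennreal (3 / pi) * (ennreal (pi / 3) * ennreal (\<Sum>n<N. real (n + 1) * (cmod (a (n + 1)))\<^sup>2)) \<le> ennreal (3 / pi) * I"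
    by (rule mult_left_mono) simp
  moreover have "ennreal (3 / pi) * (ennreal (pi / 3) * x) = x" for x
    by (simp flip: mult.assoc ennreal_mult)
  moreover have "ennreal (3 / pi) * I = 3 * dirichlet_integral f"
    by (simp add: dirichlet_integral_def I_def flip: mult.assoc ennreal_mult' ennreal_numeral)
  ultimately show ?thesis by simp
qed

section \<open>Truncations of the logarithmic series\<close>

text \<open>Summation by parts: multiplying by \<open>1 - x\<close> telescopes the powers of \<open>x\<close> and leaves the differences of
the decreasing coefficients \<open>1 / (n + 1)\<close>, whose total variation is bounded by the first of them.\<close>

lemma log_series_tail_le:
  fixes x :: "'a::{real_normed_field}"
  assumes "norm x \<le> 1" "m \<le> N"
  shows "norm (1 - x) * norm (\<Sum>n=m..<N. x ^ n / of_nat (n + 1)) \<le> 2 / real (m + 1)"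
proof -
  \<comment> \<open>The boundary term of the summation by parts belongs to the induction
    statement: adding it makes each step contribute exactly one difference of consecutive
    coefficients.\<close>
  have "norm ((1 - x) * (\<Sum>n=m..<N. x ^ n / of_nat (n + 1)) + x ^ N / of_nat (N + 1))
      \<le> 2 / real (m + 1) - 1 / real (N + 1)"
    using \<open>m \<le> N\<close>
  proof (induction N rule: dec_induct)
    case base
    have "norm (x ^ m) \<le> 1"
      using assms by (simp add: norm_power power_le_one)
    then show ?case
      by (simp add: norm_divide divide_right_mono flip: of_nat_Suc diff_divide_distrib)
  next
    case (step N)
    have nz: "of_nat (N + 1) \<noteq> (0::'a)" "of_nat (Suc N + 1) \<noteq> (0::'a)"
      by (simp_all del: of_nat_Suc of_nat_add)
    have split: "(1 - x) * (\<Sum>n=m..<Suc N. x ^ n / of_nat (n + 1)) + x ^ Suc N / of_nat (Suc N + 1)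
        = ((1 - x) * (\<Sum>n=m..<N. x ^ n / of_nat (n + 1)) + x ^ N / of_nat (N + 1))
          - x ^ Suc N * (of_real (1 / real (N + 1) - 1 / real (Suc N + 1)))"
      using step(1) by (simp add: algebra_simps diff_divide_distrib)
    have "norm (x ^ Suc N * (of_real (1 / real (N + 1) - 1 / real (Suc N + 1))))
        \<le> 1 * \<bar>1 / real (N + 1) - 1 / real (Suc N + 1)\<bar>"
      unfolding norm_mult norm_of_real norm_power
      using assms by (intro mult_right_mono power_le_one) auto
    also have "\<dots> = 1 / real (N + 1) - 1 / real (Suc N + 1)"
      by (simp add: frac_le)
    finally show ?case
      unfolding split using step.IH by (intro order_trans[OF norm_triangle_ineq4]) linarith
  qed
  moreover have "norm (x ^ N / of_nat (N + 1)) \<le> 1 / real (N + 1)"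
    using assms by (simp add: norm_divide norm_power power_le_one divide_right_mono flip: of_nat_Suc)
  ultimately have "norm ((1 - x) * (\<Sum>n=m..<N. x ^ n / of_nat (n + 1))) \<le> 2 / real (m + 1)"
    using norm_triangle_ineq4[of "(1 - x) * (\<Sum>n=m..<N. x ^ n / of_nat (n + 1)) + x ^ N / of_nat (N + 1)"
        "x ^ N / of_nat (N + 1)"] by simp
  then show ?thesis by (simp add: norm_mult)
qed

text \<open>This is a form of \<open>\<bar>ln (1 - x)\<bar> \<le> C + ln (1 / norm (1 - x))\<close> that is uniform in the
truncation.  The terms with \<open>n * norm (1 - x) < 1\<close> are bounded trivially; the remaining ones form a
tail, which summation by parts bounds by \<open>2\<close>.  The logarithm is left as a sum over conditions on
\<open>norm (1 - x)\<close>, so that integrating it in \<open>x\<close> yields measures of neighbourhoods of \<open>1\<close>.\<close>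

lemma log_series_le:
  fixes x :: "'a::{real_normed_field}"
  assumes "norm x \<le> 1"
  shows "norm (\<Sum>n<N. x ^ n / of_nat (n + 1))
    \<le> 2 + (\<Sum>n<N. if real n * norm (1 - x) < 1 then 1 / real (n + 1) else 0)"
proof -
  define S where "S = (\<lambda>A. \<Sum>n\<in>A. x ^ n / of_nat (n + 1))"
  define R where "R = (\<lambda>A. \<Sum>n\<in>A. if real n * norm (1 - x) < 1 then 1 / real (n + 1) else 0)"
  have initial: "norm (S {..<m}) \<le> R {..<m}" if "\<And>n. n < m \<Longrightarrow> real n * norm (1 - x) < 1" for m
    unfolding S_def R_def
  proof (rule sum_norm_le)
    fix n assume "n \<in> {..<m}"
    then show "norm (x ^ n / of_nat (n + 1)) \<le> (if real n * norm (1 - x) < 1 then 1 / real (n + 1) else 0)"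
      using that[of n] assms
      by (simp add: norm_divide norm_power power_le_one divide_right_mono flip: of_nat_Suc)
  qed
  show ?thesis
  proof (cases "\<exists>m<N. 1 \<le> real m * norm (1 - x)")
    case False
    then show ?thesis
      using initial[of N] by (auto simp: S_def R_def not_le)
  next
    case True
    define m where "m = (LEAST m. 1 \<le> real m * norm (1 - x))"
    have m: "1 \<le> real m * norm (1 - x)" "m < N"
      unfolding m_def using True by (auto intro: LeastI Least_le le_less_trans)
    have "norm (S {..<m}) \<le> R {..<m}"
      by (rule initial) (use not_less_Least in \<open>force simp: m_def not_le\<close>)
    also have "\<dots> \<le> R {..<N}"
      unfolding R_def using m by (intro sum_mono2) auto
    finally have 1: "norm (S {..<m}) \<le> R {..<N}" .
    have d: "0 < norm (1 - x)" using m(1) by (cases "norm (1 - x) = 0") auto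
    have "norm (1 - x) * norm (S {m..<N}) \<le> 2 / real (m + 1)"
      unfolding S_def using assms m by (intro log_series_tail_le) auto
    also have "\<dots> \<le> norm (1 - x) * 2"
    proof -
      have "real (m + 1) * norm (1 - x) = real m * norm (1 - x) + norm (1 - x)"
        by (simp add: algebra_simps)
      then have "1 \<le> real (m + 1) * norm (1 - x)"
        using m(1) d by linarith
      then show ?thesis by (simp add: field_simps)
    qed
    finally have 2: "norm (S {m..<N}) \<le> 2"
      using d by simp
    have "S {..<N} = S {..<m} + S {m..<N}"
      unfolding S_def using m(2) by (subst sum.union_disjoint[symmetric]) (auto intro!: sum.cong)
    then have "norm (S {..<N}) \<le> 2 + R {..<N}"
      using 1 2 norm_triangle_ineq[of "S {..<m}" "S {m..<N}"] by simp
    then show ?thesis by (simp add: S_def R_def)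
  qed
qed

section \<open>Schur's test for the truncated Dirichlet kernel\<close>

lemma restrict_borel_measurable:
  assumes "sets \<mu> = sets (restrict_space borel S)" "f \<in> borel_measurable borel"
  shows "f \<in> borel_measurable \<mu>"
  using assms measurable_restrict_space1[of f borel borel S] measurable_cong_sets[OF assms(1) refl]
  by blast

lemma (in finite_measure) integrable_bounded:
  fixes f :: "'a \<Rightarrow> 'b::{banach, second_countable_topology}"
  assumes "f \<in> borel_measurable M" "\<And>x. x \<in> space M \<Longrightarrow> norm (f x) \<le> bd"
  shows "integrable M f"
  using assms by (intro integrable_const_bound[of _ bd]) auto

text \<open>Let \<open>p\<close> be the polynomial with coefficients \<open>a n\<close>, and let \<open>Q\<close> be the integral of \<open>(cmod (p z))\<^sup>2\<close>.
Expanding one factor of \<open>p z * cnj (p z)\<close> gives \<open>Q = (\<Sum>n<N. a n * u n)\<close>, where \<open>u n\<close> is the integral of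
\<open>z ^ n * cnj (p z)\<close>.  By the Cauchy-Schwarz inequality, \<open>Q\<^sup>2\<close> is at most the weighted sum of the
\<open>(cmod (a n))\<^sup>2\<close> times \<open>W = (\<Sum>n<N. (cmod (u n))\<^sup>2 / real (n + 1))\<close>.

Written as a double integral, \<open>W\<close> is the quadratic form of the truncated reproducing kernel
\<open>K z \<zeta> = (\<Sum>n<N. (z * cnj \<zeta>) ^ n / of_nat (n + 1))\<close> of the Dirichlet space, evaluated at \<open>p\<close>.  The kernel is
dominated by the symmetric real kernel \<open>k\<close>, whose integrals in one variable are at most \<open>B'\<close> by the
hypothesis on \<open>B\<close>.  Schur's test gives \<open>W \<le> B' * Q\<close>, and one factor \<open>Q\<close> cancels.\<close>

lemma polynomial_L2_le_by_schur_test: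
  fixes \<mu> :: "complex measure" and a :: "nat \<Rightarrow> complex"
  assumes fin: "finite_measure \<mu>"
    and sets: "sets \<mu> = sets (restrict_space borel unit_disk)"
    and near: "\<And>\<zeta>. \<zeta> \<in> unit_disk \<Longrightarrow>
      (\<Sum>n<N. measure \<mu> {z \<in> unit_disk. real n * cmod (1 - z * cnj \<zeta>) < 1} / real (n + 1)) \<le> B"
  shows "(\<integral>\<^sup>+z. ennreal ((cmod (\<Sum>n<N. a n * z ^ n))\<^sup>2) \<partial>\<mu>)
    \<le> ennreal ((2 * measure \<mu> unit_disk + B) * (\<Sum>n<N. real (n + 1) * (cmod (a n))\<^sup>2))"
proof -
  interpret finite_measure \<mu> by fact
  interpret PP: finite_measure "\<mu> \<Otimes>\<^sub>M \<mu>" by (intro finite_measure_pair_measure fin)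
  interpret P: pair_sigma_finite \<mu> \<mu> ..
  have space: "space \<mu> = unit_disk"
    using sets_eq_imp_space_eq[OF sets] by (simp add: space_restrict_space)
  have id [measurable]: "(\<lambda>z. z) \<in> borel_measurable \<mu>"
    using sets by (rule restrict_borel_measurable) simp
  define p where "p = (\<lambda>z. \<Sum>n<N. a n * z ^ n)"
  define K where "K = (\<lambda>z \<zeta>. \<Sum>n<N. (z * cnj \<zeta>) ^ n / of_nat (n + 1))"
  define k where "k = (\<lambda>z \<zeta>. 2 + (\<Sum>n<N. if real n * cmod (1 - z * cnj \<zeta>) < 1 then 1 / real (n + 1) else 0))"
  define A where "A = (\<Sum>n<N. cmod (a n))"
  define L where "L = 2 + (\<Sum>n<N. 1 / real (n + 1))"
  define B' where "B' = 2 * measure \<mu> unit_disk + B"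
  define Q where "Q = (\<integral>z. (cmod (p z))\<^sup>2 \<partial>\<mu>)"
  define u where "u = (\<lambda>n. \<integral>z. z ^ n * cnj (p z) \<partial>\<mu>)"
  define W where "W = (\<Sum>n<N. (cmod (u n))\<^sup>2 / real (n + 1))"
  define S where "S = (\<Sum>n<N. real (n + 1) * (cmod (a n))\<^sup>2)"
  have [measurable]: "cnj \<in> borel_measurable borel"
    by (intro borel_measurable_continuous_onI continuous_intros)
  have [measurable]: "p \<in> borel_measurable borel"
    unfolding p_def by measurable
  have [measurable]: "p \<in> borel_measurable \<mu>"
    using sets \<open>p \<in> borel_measurable borel\<close> by (rule restrict_borel_measurable)
  have [measurable]: "(\<lambda>x. k (fst x) (snd x)) \<in> borel_measurable (\<mu> \<Otimes>\<^sub>M \<mu>)"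
    "(\<lambda>z. k z \<zeta>) \<in> borel_measurable \<mu>" "(\<lambda>z. K z \<zeta>) \<in> borel_measurable \<mu>" for \<zeta>
    unfolding k_def K_def by measurable
  have pA: "cmod (p z) \<le> A" if "z \<in> unit_disk" for z
    unfolding p_def A_def using that
    by (intro sum_norm_le) (auto simp: norm_mult norm_power intro!: mult_left_le power_le_one)
  have A0: "0 \<le> A" unfolding A_def by (intro sum_nonneg) auto
  have k0: "0 \<le> k z \<zeta>" for z \<zeta>
    unfolding k_def by (intro add_nonneg_nonneg sum_nonneg) auto
  have kL: "k z \<zeta> \<le> L" for z \<zeta>
    unfolding k_def L_def by (intro add_left_mono sum_mono) auto
  \<comment> \<open>The points \<open>1 - z * cnj \<zeta>\<close> and \<open>1 - \<zeta> * cnj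
    z\<close> are complex conjugates.\<close>
  have ksym: "k z \<zeta> = k \<zeta> z" for z \<zeta>
  proof -
    have "cmod (1 - z * cnj \<zeta>) = cmod (1 - \<zeta> * cnj z)"
      using complex_mod_cnj[of "1 - \<zeta> * cnj z"] by (simp add: mult.commute)
    then show ?thesis by (simp add: k_def)
  qed
  have Kk: "cmod (K z \<zeta>) \<le> k z \<zeta>" if "z \<in> unit_disk" "\<zeta> \<in> unit_disk" for z \<zeta>
    unfolding K_def k_def using that
    by (intro log_series_le) (auto simp: norm_mult intro!: mult_le_one)
  note bdd = integrable_bounded[unfolded space]
  have kint: "(\<integral>z. k z \<zeta> \<partial>\<mu>) \<le> B'" if \<zeta>: "\<zeta> \<in> unit_disk" for \<zeta>
  proof -
    define D where "D = (\<lambda>n. {z \<in> unit_disk. real n * cmod (1 - z * cnj \<zeta>) < 1})"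
    have D [measurable]: "D n \<in> sets \<mu>" for n
      unfolding D_def space[symmetric] by measurable
    have intD: "integrable \<mu> (\<lambda>z. indicator (D n) z / real (n + 1))" for n
      by (intro integrable_divide integrable_real_indicator D) (simp add: less_top[symmetric])
    have "(\<integral>z. k z \<zeta> \<partial>\<mu>) = (\<integral>z. 2 + (\<Sum>n<N. indicator (D n) z / real (n + 1)) \<partial>\<mu>)"
      by (intro Bochner_Integration.integral_cong refl)
         (auto simp: k_def D_def space indicator_def intro!: sum.cong)
    also have "\<dots> = 2 * measure \<mu> unit_disk + (\<integral>z. (\<Sum>n<N. indicator (D n) z / real (n + 1)) \<partial>\<mu>)"
      using intD by (subst Bochner_Integration.integral_add) (auto simp: space)
    also have "(\<integral>z. (\<Sum>n<N. indicator (D n) z / real (n + 1)) \<partial>\<mu>) = (\<Sum>n<N. measure \<mu> (D n) / real (n + 1))"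
      using intD by (subst Bochner_Integration.integral_sum) (auto simp: less_top[symmetric])
    also have "2 * measure \<mu> unit_disk + (\<Sum>n<N. measure \<mu> (D n) / real (n + 1)) \<le> B'"
      unfolding B'_def using near[OF \<zeta>] by (simp add: D_def)
    finally show ?thesis .
  qed
  have int_p2: "integrable \<mu> (\<lambda>z. (cmod (p z))\<^sup>2)"
    by (rule bdd[where bd = "A\<^sup>2"]) (use pA in \<open>auto intro: power_mono\<close>)
  have int_u: "integrable \<mu> (\<lambda>z. z ^ n * cnj (p z))" for n
  proof (rule bdd[where bd = A])
    fix z assume z: "z \<in> unit_disk"
    then show "norm (z ^ n * cnj (p z)) \<le> A"
      using mult_mono[OF power_le_one[of "cmod z" n] pA[OF z]] by (auto simp: norm_mult norm_power)
  qed measurable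
  have k_p2: "norm (k z \<zeta> * (cmod (p w))\<^sup>2) \<le> L * A\<^sup>2" if "w \<in> unit_disk" for z \<zeta> w
    using k0[of z \<zeta>] kL[of z \<zeta>] pA[OF that] A0
    by (simp add: abs_mult) (intro mult_mono power_mono, auto)
  have Q_u: "complex_of_real Q = (\<Sum>n<N. a n * u n)"
  proof -
    have "complex_of_real Q = (\<integral>z. complex_of_real ((cmod (p z))\<^sup>2) \<partial>\<mu>)"
      unfolding Q_def by (rule integral_complex_of_real[symmetric])
    also have "\<dots> = (\<integral>z. (\<Sum>n<N. a n * (z ^ n * cnj (p z))) \<partial>\<mu>)"
      unfolding complex_norm_square by (simp add: p_def sum_distrib_right mult.assoc)
    also have "\<dots> = (\<Sum>n<N. a n * u n)"
      unfolding u_def using int_u by (subst Bochner_Integration.integral_sum) auto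
    finally show ?thesis .
  qed
  have W_eq: "complex_of_real W = (\<integral>\<zeta>. p \<zeta> * (\<integral>z. K z \<zeta> * cnj (p z) \<partial>\<mu>) \<partial>\<mu>)"
  proof -
    have inner: "(\<integral>z. K z \<zeta> * cnj (p z) \<partial>\<mu>) = (\<Sum>n<N. cnj \<zeta> ^ n / of_nat (n + 1) * u n)" for \<zeta>
    proof -
      have "(\<integral>z. K z \<zeta> * cnj (p z) \<partial>\<mu>) = (\<integral>z. (\<Sum>n<N. cnj \<zeta> ^ n / of_nat (n + 1) * (z ^ n * cnj (p z))) \<partial>\<mu>)"
        unfolding K_def sum_distrib_right
        by (intro Bochner_Integration.integral_cong sum.cong refl) (simp add: power_mult_distrib mult_ac)
      also have "\<dots> = (\<Sum>n<N. cnj \<zeta> ^ n / of_nat (n + 1) * u n)"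
        unfolding u_def using int_u by (subst Bochner_Integration.integral_sum) auto
      finally show ?thesis .
    qed
    have cnj_u: "cnj (u n) = (\<integral>\<zeta>. cnj (\<zeta> ^ n * cnj (p \<zeta>)) \<partial>\<mu>)" for n
      unfolding u_def by (simp only: Bochner_Integration.integral_cnj)
    have int_cnj: "integrable \<mu> (\<lambda>\<zeta>. cnj (\<zeta> ^ n * cnj (p \<zeta>)))" for n
      using int_u by (rule integrable_cnj)
    have "(\<integral>\<zeta>. p \<zeta> * (\<integral>z. K z \<zeta> * cnj (p z) \<partial>\<mu>) \<partial>\<mu>)
        = (\<integral>\<zeta>. (\<Sum>n<N. u n / of_nat (n + 1) * cnj (\<zeta> ^ n * cnj (p \<zeta>))) \<partial>\<mu>)"
      unfolding inner sum_distrib_left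
      by (intro Bochner_Integration.integral_cong sum.cong refl) (simp add: mult_ac)
    also have "\<dots> = (\<Sum>n<N. u n / of_nat (n + 1) * cnj (u n))"
      unfolding cnj_u using int_cnj by (subst Bochner_Integration.integral_sum) auto
    also have "\<dots> = complex_of_real W"
      unfolding W_def of_real_sum of_real_divide complex_norm_square by simp
    finally show ?thesis ..
  qed
  define G where "G = (\<lambda>\<zeta>. \<integral>z. k z \<zeta> * (cmod (p z))\<^sup>2 \<partial>\<mu>)"
  define H where "H = (\<lambda>\<zeta>. \<integral>z. k z \<zeta> \<partial>\<mu>)"
  have [measurable]: "G \<in> borel_measurable \<mu>" "H \<in> borel_measurable \<mu>"
    "(\<lambda>\<zeta>. \<integral>z. K z \<zeta> * cnj (p z) \<partial>\<mu>) \<in> borel_measurable \<mu>"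
    unfolding G_def H_def k_def K_def by measurable
  have H0: "0 \<le> H \<zeta>" for \<zeta>
    unfolding H_def using k0 by (intro Bochner_Integration.integral_nonneg) auto
  have HB: "H \<zeta> \<le> B'" if "\<zeta> \<in> unit_disk" for \<zeta>
    unfolding H_def using that by (rule kint)
  have int_pH: "integrable \<mu> (\<lambda>\<zeta>. (cmod (p \<zeta>))\<^sup>2 * H \<zeta>)"
  proof (rule bdd[where bd = "A\<^sup>2 * B'"])
    fix \<zeta> assume \<zeta>: "\<zeta> \<in> unit_disk"
    show "norm ((cmod (p \<zeta>))\<^sup>2 * H \<zeta>) \<le> A\<^sup>2 * B'"
      using pA[OF \<zeta>] HB[OF \<zeta>] H0[of \<zeta>] A0 by (simp add: abs_mult) (intro mult_mono power_mono, auto)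
  qed measurable
  have pH_le: "(\<integral>\<zeta>. (cmod (p \<zeta>))\<^sup>2 * H \<zeta> \<partial>\<mu>) \<le> B' * Q"
  proof -
    have "(\<integral>\<zeta>. (cmod (p \<zeta>))\<^sup>2 * H \<zeta> \<partial>\<mu>) \<le> (\<integral>\<zeta>. (cmod (p \<zeta>))\<^sup>2 * B' \<partial>\<mu>)"
      using HB int_pH int_p2 by (intro Bochner_Integration.integral_mono) (auto simp: space intro!: mult_left_mono)
    then show ?thesis by (simp add: Q_def mult.commute)
  qed
  have int_k2: "integrable (\<mu> \<Otimes>\<^sub>M \<mu>) (\<lambda>(z, \<zeta>). k z \<zeta> * (cmod (p z))\<^sup>2)"
  proof (rule PP.integrable_const_bound[of _ "L * A\<^sup>2"])
    show "AE x in \<mu> \<Otimes>\<^sub>M \<mu>. norm (case x of (z, \<zeta>) \<Rightarrow> k z \<zeta> * (cmod (p z))\<^sup>2) \<le> L * A\<^sup>2"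
      using k_p2 by (intro AE_I2) (auto simp: space_pair_measure space)
  qed (unfold case_prod_beta, measurable)
  have int_G: "integrable \<mu> G"
    unfolding G_def using P.integrable_snd[OF int_k2] by simp
  have G_eq: "(\<integral>\<zeta>. G \<zeta> \<partial>\<mu>) = (\<integral>\<zeta>. (cmod (p \<zeta>))\<^sup>2 * H \<zeta> \<partial>\<mu>)"
  proof -
    have "(\<integral>\<zeta>. G \<zeta> \<partial>\<mu>) = (\<integral>z. (\<integral>\<zeta>. k z \<zeta> * (cmod (p z))\<^sup>2 \<partial>\<mu>) \<partial>\<mu>)"
      unfolding G_def using P.Fubini_integral[OF int_k2] by simp
    also have "\<dots> = (\<integral>z. (cmod (p z))\<^sup>2 * H z \<partial>\<mu>)"
      unfolding H_def by (intro Bochner_Integration.integral_cong refl, subst ksym) (simp add: mult.commute)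
    finally show ?thesis .
  qed
  \<comment> \<open>Schur's test with constant weights: the product of the two values of
    \<open>p\<close> is replaced by the mean of their squares, and by symmetry both halves
    contribute the same integral.\<close>
  have pointwise: "norm (p \<zeta> * (\<integral>z. K z \<zeta> * cnj (p z) \<partial>\<mu>)) \<le> (G \<zeta> + (cmod (p \<zeta>))\<^sup>2 * H \<zeta>) / 2"
    if \<zeta>: "\<zeta> \<in> unit_disk" for \<zeta>
  proof -
    have int1: "integrable \<mu> (\<lambda>z. k z \<zeta> * (cmod (p z))\<^sup>2)"
      using k_p2 by (intro bdd[where bd = "L * A\<^sup>2"]) auto
    have int2: "integrable \<mu> (\<lambda>z. k z \<zeta>)"
      using k0 kL by (intro bdd[where bd = L]) auto
    have "norm (p \<zeta> * (\<integral>z. K z \<zeta> * cnj (p z) \<partial>\<mu>)) = norm (\<integral>z. p \<zeta> * (K z \<zeta> * cnj (p z)) \<partial>\<mu>)"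
      by simp
    also have "\<dots> \<le> (\<integral>z. (k z \<zeta> * (cmod (p z))\<^sup>2 + (cmod (p \<zeta>))\<^sup>2 * k z \<zeta>) / 2 \<partial>\<mu>)"
    proof (rule Bochner_Integration.integral_norm_bound_integral)
      fix z assume "z \<in> space \<mu>"
      then have z: "z \<in> unit_disk" by (simp add: space)
      have "norm (p \<zeta> * (K z \<zeta> * cnj (p z))) = cmod (K z \<zeta>) * (cmod (p \<zeta>) * cmod (p z))"
        by (simp add: norm_mult)
      also have "\<dots> \<le> k z \<zeta> * (((cmod (p \<zeta>))\<^sup>2 + (cmod (p z))\<^sup>2) / 2)"
      proof (intro mult_mono Kk[OF z \<zeta>] k0)
        show "cmod (p \<zeta>) * cmod (p z) \<le> ((cmod (p \<zeta>))\<^sup>2 + (cmod (p z))\<^sup>2) / 2"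
          using sum_squares_bound[of "cmod (p \<zeta>)" "cmod (p z)"] by simp
      qed auto
      finally show "norm (p \<zeta> * (K z \<zeta> * cnj (p z))) \<le> (k z \<zeta> * (cmod (p z))\<^sup>2 + (cmod (p \<zeta>))\<^sup>2 * k z \<zeta>) / 2"
        by (simp add: algebra_simps)
    next
      show "integrable \<mu> (\<lambda>z. p \<zeta> * (K z \<zeta> * cnj (p z)))"
      proof (rule bdd[where bd = "A * (L * A)"])
        fix z assume z: "z \<in> unit_disk"
        show "norm (p \<zeta> * (K z \<zeta> * cnj (p z))) \<le> A * (L * A)"
          using pA[OF z] pA[OF \<zeta>] order_trans[OF Kk[OF z \<zeta>] kL] order_trans[OF k0 kL] A0
          unfolding norm_mult complex_mod_cnj by (intro mult_mono) auto
      qed measurable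
    next
      show "integrable \<mu> (\<lambda>z. (k z \<zeta> * (cmod (p z))\<^sup>2 + (cmod (p \<zeta>))\<^sup>2 * k z \<zeta>) / 2)"
        using int1 int2 by simp
    qed
    also have "\<dots> = (G \<zeta> + (cmod (p \<zeta>))\<^sup>2 * H \<zeta>) / 2"
      using int1 int2 by (simp add: G_def H_def)
    finally show ?thesis .
  qed
  have W_le: "W \<le> B' * Q"
  proof -
    have "W \<le> norm (complex_of_real W)" by simp
    also have "\<dots> \<le> (\<integral>\<zeta>. (G \<zeta> + (cmod (p \<zeta>))\<^sup>2 * H \<zeta>) / 2 \<partial>\<mu>)"
      unfolding W_eq
    proof (rule Bochner_Integration.integral_norm_bound_integral)
      show int: "integrable \<mu> (\<lambda>\<zeta>. (G \<zeta> + (cmod (p \<zeta>))\<^sup>2 * H \<zeta>) / 2)"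
        using int_G int_pH by simp
      show "integrable \<mu> (\<lambda>\<zeta>. p \<zeta> * (\<integral>z. K z \<zeta> * cnj (p z) \<partial>\<mu>))"
        by (rule Bochner_Integration.integrable_bound[OF int])
           (measurable, use pointwise in \<open>force simp: space intro!: AE_I2\<close>)
    qed (use pointwise space in auto)
    also have "\<dots> = (\<integral>\<zeta>. (cmod (p \<zeta>))\<^sup>2 * H \<zeta> \<partial>\<mu>)"
      using int_G int_pH by (simp add: G_eq)
    also have "\<dots> \<le> B' * Q" by (rule pH_le)
    finally show ?thesis .
  qed
  have S0: "0 \<le> S" unfolding S_def by (intro sum_nonneg) auto
  have Q0: "0 \<le> Q" unfolding Q_def by (intro Bochner_Integration.integral_nonneg) auto
  have "Q \<le> (\<Sum>n<N. cmod (a n) * cmod (u n))"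
  proof -
    have "Q \<le> norm (complex_of_real Q)" by simp
    also have "\<dots> \<le> (\<Sum>n<N. cmod (a n * u n))" unfolding Q_u by (rule norm_sum)
    finally show ?thesis by (simp add: norm_mult)
  qed
  also have "\<dots> = (\<Sum>n<N. (sqrt (real (n + 1)) * cmod (a n)) * (cmod (u n) / sqrt (real (n + 1))))"
    by (intro sum.cong refl) (simp add: field_simps)
  finally have "Q\<^sup>2 \<le> (\<Sum>n<N. (sqrt (real (n + 1)) * cmod (a n)) * (cmod (u n) / sqrt (real (n + 1))))\<^sup>2"
    using Q0 by (intro power_mono)
  also have "\<dots> \<le> (\<Sum>n<N. (sqrt (real (n + 1)) * cmod (a n))\<^sup>2) * (\<Sum>n<N. (cmod (u n) / sqrt (real (n + 1)))\<^sup>2)"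
    by (rule Cauchy_Schwarz_ineq_sum)
  also have "\<dots> = S * W"
    by (simp add: S_def W_def power_mult_distrib power_divide)
  also have "\<dots> \<le> S * (B' * Q)" using W_le S0 by (rule mult_left_mono)
  finally have "Q * Q \<le> (B' * S) * Q" by (simp add: power2_eq_square mult_ac)
  moreover have "0 \<le> B' * S"
  proof -
    have "0 \<le> B'" using H0[of 0] HB[of 0] by simp
    then show ?thesis using S0 by simp
  qed
  ultimately have "Q \<le> B' * S"
    using Q0 by (cases "Q = 0") (auto simp: mult_le_cancel_right)
  then show ?thesis
    using nn_integral_eq_integral[OF int_p2] by (simp add: Q_def S_def B'_def p_def ennreal_leI)
qed

section \<open>Carleson boxes and neighbourhoods of the diagonal\<close>

text \<open>The exact value is \<open>2 * s\<close>, but the parameter interval may leave \<open>{0..<2 * pi}\<close> at either end.  The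
bounds come from one half of the interval, which stays inside, and from the three translates of the
interval that can meet \<open>{0..<2 * pi}\<close>.\<close>

lemma arclength_symmetric_arc:
  assumes \<alpha>: "0 \<le> \<alpha>" "\<alpha> < 2 * pi" and s: "0 < s" "s < pi"
  shows "s \<le> arclength (cis ` {\<alpha> - s..\<alpha> + s})" "arclength (cis ` {\<alpha> - s..\<alpha> + s}) \<le> 6 * s"
proof -
  define E where "E = {\<theta> \<in> {0..<2 * pi}. cis \<theta> \<in> cis ` {\<alpha> - s..\<alpha> + s}}"
  have "closed (cis ` {\<alpha> - s..\<alpha> + s})"
    by (intro compact_imp_closed compact_continuous_image continuous_intros compact_Icc)
  moreover have "continuous_on UNIV cis" by (intro continuous_intros)
  ultimately have "closed (cis -` (cis ` {\<alpha> - s..\<alpha> + s}))"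
    by (simp add: continuous_closed_vimage continuous_on_eq_continuous_at)
  moreover have "E = {0..<2 * pi} \<inter> cis -` (cis ` {\<alpha> - s..\<alpha> + s})"
    by (auto simp: E_def)
  ultimately have [measurable]: "E \<in> sets borel"
    by auto
  have Efm: "E \<in> fmeasurable lborel"
  proof (rule fmeasurableI2)
    show "{0..2 * pi} \<in> fmeasurable lborel" by (intro fmeasurable_compact compact_Icc)
    show "E \<subseteq> {0..2 * pi}" by (auto simp: E_def)
  qed simp
  have arc: "arclength (cis ` {\<alpha> - s..\<alpha> + s}) = measure lborel E"
    by (simp add: arclength_def E_def)
  let ?J = "if \<alpha> < pi then {\<alpha>..\<alpha> + s} else {\<alpha> - s..\<alpha>}"
  have "s = measure lborel ?J" using s by simp
  also have "\<dots> \<le> measure lborel E"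
    using Efm by (intro measure_mono_fmeasurable) (use \<alpha> s in \<open>auto simp: E_def\<close>)
  finally show "s \<le> arclength (cis ` {\<alpha> - s..\<alpha> + s})" by (simp add: arc)
  let ?T = "\<lambda>c. {c + \<alpha> - s..c + \<alpha> + s}"
  have "E \<subseteq> ?T 0 \<union> (?T (2 * pi) \<union> ?T (- 2 * pi))"
  proof
    fix \<theta> assume "\<theta> \<in> E"
    then obtain \<eta> where \<eta>: "0 \<le> \<theta>" "\<theta> < 2 * pi" "\<alpha> - s \<le> \<eta>" "\<eta> \<le> \<alpha> + s" "cis \<theta> = cis \<eta>"
      by (auto simp: E_def)
    from \<eta>(5) have "\<exists>k::int. \<i> * of_real \<theta> = \<i> * of_real \<eta> + of_int (2 * k) * of_real pi * \<i>"
      unfolding cis_conv_exp exp_eq by simp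
    then obtain k :: int where "\<i> * of_real \<theta> = \<i> * of_real \<eta> + of_int (2 * k) * of_real pi * \<i>" ..
    from arg_cong[OF this, of Im] have k: "\<theta> = \<eta> + 2 * pi * of_int k" by simp
    have "2 * pi * of_int k < 2 * pi * 2" "2 * pi * (-2) < 2 * pi * of_int k"
      using k \<eta> \<alpha> s by linarith+
    then have "real_of_int k < 2" "- 2 < real_of_int k"
      using pi_gt_zero by (auto simp only: mult_less_cancel_left_pos)
    then have "k < 2" "- 2 < k" by linarith+
    then have "k \<in> {-1, 0, 1}" by auto
    then show "\<theta> \<in> ?T 0 \<union> (?T (2 * pi) \<union> ?T (- 2 * pi))"
      using k \<eta> by auto
  qed
  then have "measure lborel E \<le> measure lborel (?T 0 \<union> (?T (2 * pi) \<union> ?T (- 2 * pi)))"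
    by (intro measure_mono_fmeasurable fmeasurable.Un fmeasurable_compact compact_Icc) auto
  also have "\<dots> \<le> measure lborel (?T 0) + (measure lborel (?T (2 * pi)) + measure lborel (?T (- 2 * pi)))"
    by (intro order_trans[OF measure_Un_le] add_left_mono measure_Un_le) auto
  also have "\<dots> = 6 * s" using s by simp
  finally show "arclength (cis ` {\<alpha> - s..\<alpha> + s}) \<le> 6 * s" by (simp add: arc)
qed

text \<open>For a short arc the origin is not in the box, so the box is described by Borel conditions on
\<open>cmod z\<close> and \<open>sgn z\<close>.\<close>

lemma carleson_box_measurable:
  assumes I: "circle_arc I" "closed I" and "arclength I < 1"
  shows "carleson_box I \<in> sets (restrict_space borel unit_disk)"
proof -
  define A where "A = {z::complex. 1 - arclength I < cmod z \<and> sgn z \<in> I}"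
  obtain J where J: "I = cis ` J" using I by (auto simp: circle_arc_def)
  have "A = {z. 1 - arclength I < cmod z} \<inter> sgn -` I" by (auto simp: A_def)
  moreover have "(sgn :: complex \<Rightarrow> complex) \<in> borel_measurable borel"
    unfolding sgn_div_norm by measurable
  then have "(sgn :: complex \<Rightarrow> complex) -` I \<in> sets borel"
    using I(2) by (metis borel_closed measurable_sets_borel)
  ultimately have A: "A \<in> sets borel"
    by auto
  have "carleson_box I = unit_disk \<inter> A"
  proof safe
    fix z assume "z \<in> carleson_box I"
    then obtain r \<theta> where z: "z = of_real r * cis \<theta>" "1 - arclength I < r" "r < 1" "cis \<theta> \<in> I"
      by (auto simp: carleson_box_def)
    have "0 < r" using z(2) assms(3) by simp
    then show "z \<in> unit_disk" "z \<in> A"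
      using z by (auto simp: A_def norm_mult sgn_mult sgn_of_real sgn_eq)
  next
    fix z assume z: "z \<in> unit_disk" "z \<in> A"
    then obtain \<theta> where \<theta>: "sgn z = cis \<theta>" "cis \<theta> \<in> I" by (auto simp: A_def J)
    have "z = of_real (cmod z) * sgn z" by (simp add: sgn_eq)
    then have "z = of_real (cmod z) * cis \<theta>" by (simp add: \<theta>)
    then show "z \<in> carleson_box I"
      using z \<theta>(2) unfolding carleson_box_def A_def by fastforce
  qed
  then show ?thesis
    using A by (auto simp: sets_restrict_space)
qed

text \<open>If \<open>w = z * cnj \<zeta>\<close> lies within \<open>t\<close> of \<open>1\<close>, then \<open>1 - cmod z \<le> 1 - cmod w \<le> t\<close>, and the argument of
\<open>w\<close>, which is the angle between \<open>z\<close> and \<open>\<zeta>\<close>, is at most \<open>2 * t\<close>.  Hence \<open>z\<close> lies in the box over the arc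
of half-length \<open>pi * t\<close> around the direction of \<open>\<zeta>\<close>.  The arc is taken closed so that its box is a
Borel set.\<close>

lemma near_diagonal_subset_carleson_box:
  assumes \<zeta>: "cmod \<zeta> < 1" and t: "0 < t" "6 * pi * t < 1"
  obtains I where "circle_arc I" "closed I" "pi * t \<le> arclength I" "arclength I \<le> 6 * pi * t"
    "{z \<in> unit_disk. cmod (1 - z * cnj \<zeta>) < t} \<subseteq> carleson_box I"
proof
  define \<alpha> where "\<alpha> = Arg2pi \<zeta>"
  define I where "I = cis ` {\<alpha> - pi * t..\<alpha> + pi * t}"
  have \<alpha>: "0 \<le> \<alpha>" "\<alpha> < 2 * pi" by (auto simp: \<alpha>_def Arg2pi_ge_0 Arg2pi_lt_2pi)
  have "3 * t \<le> pi * t" using t pi_gt3 by (intro mult_right_mono) auto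
  moreover have "6 * (pi * t) < 1" using t by (simp add: mult.assoc)
  ultimately have t2: "t < 1 / 2" and tpi: "t \<le> pi * t" "2 * t \<le> pi * t" using t by linarith+
  have pit: "0 < pi * t" "pi * t < pi" using t t2 by auto
  show "circle_arc I" unfolding circle_arc_def I_def by (auto intro!: exI[of _ "{\<alpha> - pi * t..\<alpha> + pi * t}"])
  show "closed I" unfolding I_def
    by (intro compact_imp_closed compact_continuous_image continuous_intros compact_Icc)
  show ge: "pi * t \<le> arclength I" and "arclength I \<le> 6 * pi * t"
    using arclength_symmetric_arc[OF \<alpha> pit] by (auto simp: I_def)
  have \<zeta>_eq: "\<zeta> = of_real (cmod \<zeta>) * cis \<alpha>"
    using Arg2pi[of \<zeta>] by (simp add: \<alpha>_def cis_conv_exp is_Arg_def)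
  show "{z \<in> unit_disk. cmod (1 - z * cnj \<zeta>) < t} \<subseteq> carleson_box I"
  proof
    fix z assume "z \<in> {z \<in> unit_disk. cmod (1 - z * cnj \<zeta>) < t}"
    then have z: "cmod z < 1" and near: "cmod (1 - z * cnj \<zeta>) < t" by auto
    define w where "w = z * cnj \<zeta>"
    define \<psi> where "\<psi> = Im (Ln w)"
    have w0: "w \<noteq> 0" using near t2 t by (auto simp: w_def)
    have "cmod w \<le> cmod z"
      using \<zeta> by (simp add: w_def norm_mult mult_left_le)
    moreover have "1 - cmod w \<le> cmod (1 - w)"
      using norm_triangle_ineq2[of 1 w] by simp
    ultimately have r: "1 - arclength I < cmod z"
      using near tpi ge by (simp add: w_def)
    have "\<bar>\<psi>\<bar> \<le> cmod (Ln (1 + (w - 1)))" by (simp add: \<psi>_def abs_Im_le_cmod)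
    also have "\<dots> \<le> 2 * cmod (w - 1)"
      using near t2 by (intro norm_Ln_le) (simp add: w_def norm_minus_commute)
    also have "\<dots> \<le> pi * t"
      using near tpi by (simp add: w_def norm_minus_commute)
    finally have \<psi>: "\<bar>\<psi>\<bar> \<le> pi * t" .
    have "w = exp (Ln w)" using w0 by simp
    also have "\<dots> = of_real (cmod w) * cis \<psi>"
      using w0 by (subst exp_eq_polar) (simp add: \<psi>_def)
    finally have "z * cnj \<zeta> = of_real (cmod z) * of_real (cmod \<zeta>) * cis \<psi>"
      by (simp add: w_def norm_mult)
    moreover have "cnj \<zeta> = of_real (cmod \<zeta>) * cis (- \<alpha>)"
      by (subst \<zeta>_eq) (simp add: cis_cnj)
    moreover have "\<zeta> \<noteq> 0" using w0 by (auto simp: w_def)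
    ultimately have "z * cis (- \<alpha>) = of_real (cmod z) * cis \<psi>"
      by (simp add: mult_ac)
    then have "z * cis (- \<alpha>) * cis \<alpha> = of_real (cmod z) * cis \<psi> * cis \<alpha>" by simp
    then have "z = of_real (cmod z) * cis (\<alpha> + \<psi>)"
      by (simp add: mult.assoc cis_mult add.commute)
    moreover have "cis (\<alpha> + \<psi>) \<in> I"
      unfolding I_def using \<psi> by (intro imageI) (auto simp: abs_le_iff)
    ultimately show "z \<in> carleson_box I"
      using r z unfolding carleson_box_def by (intro CollectI exI[of _ "cmod z"] exI[of _ "\<alpha> + \<psi>"]) auto
  qed
qed

section \<open>Consequences of the box condition\<close>

text \<open>A comparison of a sum with an integral on the intervals between consecutive points \<open>c / n\<close>: on
\<open>{c / (n + 1)<..c / n}\<close> the function \<open>\<phi>\<close> is at least its value at the left end, \<open>1 / x\<close> is at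
least \<open>n / c\<close>, and the length is \<open>c / (n * (n + 1))\<close>.\<close>

lemma sum_dini_samples_le_integral:
  fixes \<phi> :: "real \<Rightarrow> real"
  assumes nonneg: "\<And>x. x \<in> {0<..b} \<Longrightarrow> 0 \<le> \<phi> x"
    and mono: "mono_on {0<..b} \<phi>"
    and int: "set_integrable lborel {0<..b} (\<lambda>x. \<phi> x / x)"
    and c: "0 < c" "c / real m \<le> b" "0 < m"
  shows "(\<Sum>n=m..<N. \<phi> (c / real (n + 1)) / real (n + 1)) \<le> (LINT x:{0<..b}|lborel. \<phi> x / x)"
proof -
  define A where "A = (\<lambda>n. {c / real (n + 1)<..c / real n})"
  have A: "A n \<subseteq> {0<..b}" if "m \<le> n" for n
  proof -
    have "c / real n \<le> c / real m"
      using that c by (intro divide_left_mono) auto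
    moreover have "0 < c / real (n + 1)" using c by simp
    ultimately show ?thesis
      unfolding A_def using c(2) by (intro subsetI) (simp only: greaterThanAtMost_iff, linarith)
  qed
  have disj: "disjoint_family_on A {m..<N}"
  proof -
    have "A i \<inter> A j = {}" if "i < j" "m \<le> i" for i j
    proof -
      have "c / real j \<le> c / real (i + 1)"
        using that c by (intro divide_left_mono) auto
      then show ?thesis by (auto simp: A_def)
    qed
    then show ?thesis
      unfolding disjoint_family_on_def by (metis Int_commute atLeastLessThan_iff linorder_neqE_nat)
  qed
  have intA: "set_integrable lborel (A n) (\<lambda>x. \<phi> x / x)" if "m \<le> n" for n
    by (rule set_integrable_subset[OF int _ A[OF that]]) (auto simp: A_def)
  have sample: "\<phi> (c / real (n + 1)) / real (n + 1) \<le> (LINT x:A n|lborel. \<phi> x / x)" if n: "m \<le> n" for n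
  proof -
    define y where "y = c / real (n + 1)"
    define k where "k = \<phi> y / (c / real n)"
    have n0: "0 < n" using n c by simp
    have len: "y \<le> c / real n" unfolding y_def using c n0 by (intro divide_left_mono) auto
    have y: "0 < y" "y \<in> {0<..b}"
      using len A[OF n] c n0 order_trans[OF divide_left_mono[of "real m" "real n" c] c(2)] n
      by (auto simp: y_def)
    have "\<phi> y / real (n + 1) = (LINT x:A n|lborel. k)"
    proof -
      have "(LINT x:A n|lborel. k) = (c / real n - y) * k"
        using len by (simp add: set_lebesgue_integral_def A_def y_def)
      also have "c / real n - y = (c / real n) / real (n + 1)"
        using c n0 by (simp add: y_def field_simps)
      also have "\<dots> * k = \<phi> y / real (n + 1)"
        using c n0 by (simp add: k_def)
      finally show ?thesis ..
    qed
    also have "\<dots> \<le> (LINT x:A n|lborel. \<phi> x / x)"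
    proof (rule set_integral_mono)
      show "set_integrable lborel (A n) (\<lambda>x. k)"
        unfolding set_integrable_def A_def
        using len by (intro integrable_scaleR_left integrable_real_indicator) (auto simp: y_def)
      fix x assume x: "x \<in> A n"
      then have "\<phi> y \<le> \<phi> x"
        using A[OF n] y by (intro mono_onD[OF mono]) (auto simp: A_def y_def)
      moreover have "0 < x" "x \<le> c / real n" "0 \<le> \<phi> y"
        using x A[OF n] y nonneg by (auto simp: A_def)
      ultimately show "k \<le> \<phi> x / x"
        unfolding k_def by (intro frac_le) auto
    qed (use intA n in auto)
    finally show ?thesis by (simp add: y_def)
  qed
  have "(\<Sum>n=m..<N. \<phi> (c / real (n + 1)) / real (n + 1)) \<le> (\<Sum>n=m..<N. LINT x:A n|lborel. \<phi> x / x)"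
    by (intro sum_mono sample) auto
  also have "\<dots> = (LINT x:(\<Union>n\<in>{m..<N}. A n)|lborel. \<phi> x / x)"
    by (rule set_integral_finite_Union[symmetric]) (auto simp: disj intA, simp add: A_def)
  also have "\<dots> \<le> (LINT x:{0<..b}|lborel. \<phi> x / x)"
  proof -
    have sub: "(\<Union>n\<in>{m..<N}. A n) \<subseteq> {0<..b}"
      by (intro UN_least A) auto
    have "set_integrable lborel (\<Union>n\<in>{m..<N}. A n) (\<lambda>x. \<phi> x / x)"
      by (rule set_integrable_subset[OF int _ sub]) (auto simp: A_def)
    moreover have "indicator (\<Union>n\<in>{m..<N}. A n) x *\<^sub>R (\<phi> x / x) \<le> indicator {0<..b} x *\<^sub>R (\<phi> x / x)" for x
      using subsetD[OF sub, of x] nonneg[of x] by (auto simp: indicator_def)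
    ultimately show ?thesis
      using int unfolding set_lebesgue_integral_def set_integrable_def by (intro integral_mono)
  qed
  finally show ?thesis .
qed

text \<open>For large \<open>n\<close> the set of all \<open>z\<close> within \<open>1 / n\<close> of the diagonal lies in a box over an arc of length at
most \<open>6 * pi / n\<close>, so that the box condition and the integrability of \<open>\<phi> x / x\<close> control the tail of the
sum uniformly in \<open>\<zeta>\<close>.  The finitely many other terms are at most the total mass.\<close>

lemma box_condition_near_diagonal_sum_bounded:
  fixes \<mu> :: "complex measure" and \<phi> :: "real \<Rightarrow> real"
  assumes fin: "finite_measure \<mu>"
    and sets: "sets \<mu> = sets (restrict_space borel unit_disk)"
    and nonneg: "\<And>x. x \<in> {0<..2 * pi} \<Longrightarrow> 0 \<le> \<phi> x"
    and mono: "mono_on {0<..2 * pi} \<phi>"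
    and int: "set_integrable lborel {0<..2 * pi} (\<lambda>x. \<phi> x / x)"
    and box: "carleson_box_bigo \<mu> \<phi>"
  obtains B where "\<And>\<zeta> N. \<zeta> \<in> unit_disk \<Longrightarrow>
      (\<Sum>n<N. measure \<mu> {z \<in> unit_disk. real n * cmod (1 - z * cnj \<zeta>) < 1} / real (n + 1)) \<le> B"
proof -
  interpret finite_measure \<mu> by fact
  have space: "space \<mu> = unit_disk"
    using sets_eq_imp_space_eq[OF sets] by (simp add: space_restrict_space)
  obtain C \<delta> where C: "0 < C" "0 < \<delta>"
    and bigo: "\<And>I. circle_arc I \<Longrightarrow> 0 < arclength I \<Longrightarrow> arclength I < \<delta> \<Longrightarrow>
      measure \<mu> (carleson_box I) \<le> C * \<phi> (arclength I)"
    using box unfolding carleson_box_bigo_def by blast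
  define c where "c = 6 * pi"
  define J where "J = (LINT x:{0<..2 * pi}|lborel. \<phi> x / x)"
  define M where "M = measure \<mu> unit_disk"
  \<comment> \<open>From index \<open>m\<close> on, the arcs are shorter than \<open>1\<close>,
    which makes their boxes measurable, and shorter than \<open>\<delta>\<close>.\<close>
  obtain m :: nat where "max c (c / \<delta>) < real m"
    using reals_Archimedean2 by blast
  then have m: "c < real m" "c / \<delta> < real m" by auto
  have c0: "0 < c" by (simp add: c_def)
  have m0: "0 < m" using m c0 by (cases m) auto
  have small: "c / real (n + 1) < 1" "c / real (n + 1) < \<delta>" if "m \<le> n" for n
  proof -
    have "real m < real (n + 1)" using that by simp
    then have "c < real (n + 1)" "c / \<delta> < real (n + 1)" using m by linarith+
    then show "c / real (n + 1) < 1" "c / real (n + 1) < \<delta>"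
      using C by (simp_all add: divide_simps mult.commute del: of_nat_add of_nat_Suc)
  qed
  have far: "measure \<mu> {z \<in> unit_disk. real (n + 1) * cmod (1 - z * cnj \<zeta>) < 1} \<le> C * \<phi> (c / real (n + 1))"
    if \<zeta>: "\<zeta> \<in> unit_disk" and n: "m \<le> n" for \<zeta> n
  proof -
    define t where "t = 1 / real (n + 1)"
    have t: "0 < t" "6 * pi * t < 1" "c / real (n + 1) = 6 * pi * t"
      using small(1)[OF n] by (auto simp: t_def c_def)
    obtain I where I: "circle_arc I" "closed I" "pi * t \<le> arclength I" "arclength I \<le> 6 * pi * t"
      "{z \<in> unit_disk. cmod (1 - z * cnj \<zeta>) < t} \<subseteq> carleson_box I"
      using near_diagonal_subset_carleson_box[of \<zeta> t] \<zeta> t by auto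
    have len: "0 < arclength I" "arclength I < 1" "arclength I < \<delta>"
      using I(3,4) t(2,3) small(2)[OF n] mult_pos_pos[OF pi_gt_zero t(1)] by linarith+
    have "{z \<in> unit_disk. real (n + 1) * cmod (1 - z * cnj \<zeta>) < 1} = {z \<in> unit_disk. cmod (1 - z * cnj \<zeta>) < t}"
      unfolding t_def by (simp add: field_simps del: of_nat_add of_nat_Suc)
    then have "measure \<mu> {z \<in> unit_disk. real (n + 1) * cmod (1 - z * cnj \<zeta>) < 1} \<le> measure \<mu> (carleson_box I)"
      using I(5) carleson_box_measurable[OF I(1,2) len(2)] sets by (auto intro!: finite_measure_mono)
    also have "\<dots> \<le> C * \<phi> (arclength I)"
      using bigo I(1) len by blast
    also have "\<dots> \<le> C * \<phi> (c / real (n + 1))"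
    proof (intro mult_left_mono mono_onD[OF mono])
      have "6 * pi * t \<le> 2 * pi" using t(2) pi_gt3 by linarith
      then show "arclength I \<in> {0<..2 * pi}" "c / real (n + 1) \<in> {0<..2 * pi}"
        unfolding t(3) greaterThanAtMost_iff using I(4) len(1) by linarith+
      show "arclength I \<le> c / real (n + 1)" unfolding t(3) by (fact I(4))
    qed (use C(1) in simp)
    finally show ?thesis .
  qed
  have meas_le: "measure \<mu> X \<le> M" for X
    unfolding M_def space[symmetric] by (rule bounded_measure)
  have bound: "(\<Sum>n<N. measure \<mu> {z \<in> unit_disk. real n * cmod (1 - z * cnj \<zeta>) < 1} / real (n + 1))
      \<le> real (m + 1) * M + C * J" if \<zeta>: "\<zeta> \<in> unit_disk" for \<zeta> N
  proof -
    define d where "d = (\<lambda>n. measure \<mu> {z \<in> unit_disk. real n * cmod (1 - z * cnj \<zeta>) < 1} / real (n + 1))"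
    have d0: "0 \<le> d n" for n by (simp add: d_def)
    have dM: "d n \<le> M" for n
    proof -
      have "d n \<le> measure \<mu> {z \<in> unit_disk. real n * cmod (1 - z * cnj \<zeta>) < 1}"
        using divide_left_mono[of 1 "real (n + 1)"
          "measure \<mu> {z \<in> unit_disk. real n * cmod (1 - z * cnj \<zeta>) < 1}"] by (simp add: d_def)
      then show ?thesis using meas_le order_trans by blast
    qed
    have "(\<Sum>n<N. d n) \<le> (\<Sum>n\<in>{..<m + 1} \<union> {m + 1..<N + 1}. d n)"
      using d0 by (intro sum_mono2) auto
    also have "\<dots> = (\<Sum>n<m + 1. d n) + (\<Sum>n=m + 1..<N + 1. d n)"
      by (rule sum.union_disjoint) auto
    also have "(\<Sum>n<m + 1. d n) \<le> real (m + 1) * M"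
      using sum_bounded_above[of "{..<m + 1}" d M] dM by simp
    also have "(\<Sum>n=m + 1..<N + 1. d n) = (\<Sum>n=m..<N. d (n + 1))"
      by (rule sum.shift_bounds_nat_ivl)
    also have "\<dots> \<le> (\<Sum>n=m..<N. C * (\<phi> (c / real (n + 1)) / real (n + 1)))"
    proof (rule sum_mono)
      fix n assume "n \<in> {m..<N}"
      then have n: "m \<le> n" by simp
      have "d (n + 1) \<le> measure \<mu> {z \<in> unit_disk. real (n + 1) * cmod (1 - z * cnj \<zeta>) < 1} / real (n + 1)"
        unfolding d_def by (intro divide_left_mono) auto
      also have "\<dots> \<le> C * \<phi> (c / real (n + 1)) / real (n + 1)"
        using far[OF \<zeta> n] by (intro divide_right_mono) auto
      finally show "d (n + 1) \<le> C * (\<phi> (c / real (n + 1)) / real (n + 1))" by simp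
    qed
    also have "\<dots> = C * (\<Sum>n=m..<N. \<phi> (c / real (n + 1)) / real (n + 1))"
      by (rule sum_distrib_left[symmetric])
    also have "\<dots> \<le> C * J"
    proof -
      have "c / real m \<le> 1" using m m0 by simp
      then have "c / real m \<le> 2 * pi" using pi_gt3 by linarith
      then show ?thesis
        unfolding J_def using sum_dini_samples_le_integral[OF nonneg mono int c0 _ m0] C(1)
        by (intro mult_left_mono) auto
    qed
    finally show ?thesis by (simp add: d_def)
  qed
  show ?thesis by (rule that[OF bound])
qed

section \<open>Carleson measures for the Dirichlet space\<close>

theorem theorem1p1:
  fixes \<mu> :: "complex measure" and \<phi> :: "real \<Rightarrow> real"
  assumes "finite_measure \<mu>"
    and "sets \<mu> = sets (restrict_space borel unit_disk)"
    and "\<And>x. x \<in> {0<..2 * pi} \<Longrightarrow> 0 < \<phi> x"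
    and "mono_on {0<..2 * pi} \<phi>"
    and "set_integrable lborel {0<..2 * pi} (\<lambda>x. \<phi> x / x)"
    and "carleson_box_bigo \<mu> \<phi>"
  shows "dirichlet_carleson_measure \<mu>"
proof -
  have space: "space \<mu> = unit_disk"
    using sets_eq_imp_space_eq[OF assms(2)] by (simp add: space_restrict_space)
  obtain B where B: "\<And>\<zeta> N. \<zeta> \<in> unit_disk \<Longrightarrow>
      (\<Sum>n<N. measure \<mu> {z \<in> unit_disk. real n * cmod (1 - z * cnj \<zeta>) < 1} / real (n + 1)) \<le> B"
    by (rule box_condition_near_diagonal_sum_bounded[OF assms(1,2) less_imp_le[OF assms(3)] assms(4-6)]) auto
  define B' where "B' = 2 * measure \<mu> unit_disk + B"
  have B': "0 \<le> B'"
    using B[of 0 0] by (simp add: B'_def)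
  have "(\<integral>\<^sup>+z. ennreal ((cmod (f z))\<^sup>2) \<partial>\<mu>) \<le> ennreal (6 * B' * (dirichlet_norm f)\<^sup>2)"
    if f: "f \<in> dirichlet_space" for f
  proof -
    define a where "a = (\<lambda>n. (deriv ^^ n) f 0 / fact n)"
    define D where "D = enn2real (dirichlet_integral f)"
    define p where "p = (\<lambda>N z. \<Sum>n<N. a n * z ^ n)"
    have hol: "f holomorphic_on unit_disk" and fin: "dirichlet_integral f < \<infinity>"
      using f by (auto simp: dirichlet_space_def)
    have D: "dirichlet_integral f = ennreal D" "0 \<le> D"
      using fin by (auto simp: D_def)
    have norm: "(dirichlet_norm f)\<^sup>2 = (cmod (f 0))\<^sup>2 + D"
      using D by (simp add: dirichlet_norm_def D_def)
    \<comment> \<open>The weights \<open>n + 1\<close> are at most \<open>2 * n\<close> for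
      positive \<open>n\<close>, and the coefficient bound for \<open>f\<close> costs a factor
      \<open>3\<close>; together they give \<open>6\<close>.\<close>
    have coeffs: "(\<Sum>n<N. real (n + 1) * (cmod (a n))\<^sup>2) \<le> 6 * (dirichlet_norm f)\<^sup>2" for N
    proof -
      have "ennreal (\<Sum>n<N. real (n + 1) * (cmod (a (n + 1)))\<^sup>2) \<le> ennreal (3 * D)"
        using taylor_coeffs_le_dirichlet_integral[OF hol, of N] D
        by (simp add: a_def ennreal_mult)
      then have le: "(\<Sum>n<N. real (n + 1) * (cmod (a (n + 1)))\<^sup>2) \<le> 3 * D"
        using D by (simp add: ennreal_le_iff)
      have "(\<Sum>n<N. real (n + 1) * (cmod (a n))\<^sup>2) \<le> (\<Sum>n<Suc N. real (n + 1) * (cmod (a n))\<^sup>2)"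
        by simp
      also have "\<dots> = (cmod (a 0))\<^sup>2 + (\<Sum>n<N. real (n + 2) * (cmod (a (n + 1)))\<^sup>2)"
        by (subst sum.lessThan_Suc_shift) (simp add: add.commute)
      also have "(\<Sum>n<N. real (n + 2) * (cmod (a (n + 1)))\<^sup>2) \<le> (\<Sum>n<N. 2 * (real (n + 1) * (cmod (a (n + 1)))\<^sup>2))"
        unfolding mult.assoc[symmetric] by (intro sum_mono mult_right_mono) auto
      also have "\<dots> \<le> 2 * (3 * D)"
        using le by (simp add: sum_distrib_left[symmetric])
      also have "(cmod (a 0))\<^sup>2 + 2 * (3 * D) \<le> 6 * (dirichlet_norm f)\<^sup>2"
        by (simp add: norm a_def)
      finally show ?thesis by simp
    qed
    have lim: "(\<lambda>N. ennreal ((cmod (p N z))\<^sup>2)) \<longlonglongrightarrow> ennreal ((cmod (f z))\<^sup>2)" if "z \<in> unit_disk" for z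
    proof -
      have "(\<lambda>n. a n * z ^ n) sums f z"
        using holomorphic_power_series[OF hol that] by (simp add: a_def)
      then show ?thesis
        unfolding sums_def p_def by (intro tendsto_ennrealI tendsto_intros)
    qed
    have "(\<integral>\<^sup>+z. ennreal ((cmod (f z))\<^sup>2) \<partial>\<mu>) = (\<integral>\<^sup>+z. liminf (\<lambda>N. ennreal ((cmod (p N z))\<^sup>2)) \<partial>\<mu>)"
      using lim by (intro nn_integral_cong) (simp add: space lim_imp_Liminf[symmetric])
    also have "\<dots> \<le> liminf (\<lambda>N. \<integral>\<^sup>+z. ennreal ((cmod (p N z))\<^sup>2) \<partial>\<mu>)"
      unfolding p_def by (intro nn_integral_liminf restrict_borel_measurable[OF assms(2)]) measurable
    also have "\<dots> \<le> ennreal (6 * B' * (dirichlet_norm f)\<^sup>2)"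
    proof (intro Liminf_le always_eventually allI)
      fix N
      have "(\<integral>\<^sup>+z. ennreal ((cmod (p N z))\<^sup>2) \<partial>\<mu>)
          \<le> ennreal (B' * (\<Sum>n<N. real (n + 1) * (cmod (a n))\<^sup>2))"
        unfolding p_def B'_def using assms(1,2) B by (rule polynomial_L2_le_by_schur_test)
      also have "\<dots> \<le> ennreal (6 * B' * (dirichlet_norm f)\<^sup>2)"
        using mult_left_mono[OF coeffs B'] by (intro ennreal_leI) (simp add: mult_ac)
      finally show "(\<integral>\<^sup>+z. ennreal ((cmod (p N z))\<^sup>2) \<partial>\<mu>) \<le> ennreal (6 * B' * (dirichlet_norm f)\<^sup>2)" .
    qed simp
    finally show ?thesis .
  qed
  then show ?thesis
    unfolding dirichlet_carleson_measure_def by blast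
qed

end
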